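(* The three-stage two-parameter EERK3-2 method with $c_2=\frac34$ and $c_3=\frac35$, where $g_h$ is Lipschitz continuous with constant $\ell_g>0$ and $\kappa\ge2\ell_g$, preserves the energy dissipation law at all stages: for every $\tau>0$, $n\ge1$ and $1\le j\le3$, $$E[U^{n,j+1}]-E[U^{n,1}]\le-\frac1\tau\sum_{k=1}^{j}\Big\langle\delta_\tau U^{n,k+1},\sum_{\ell=1}^{k}d^{(3,2)}_{k\ell}(\tfrac34,\tfrac35,-\tau L_\kappa)\,\delta_\tau U^{n,\ell+1}\Big\rangle\le0,$$ where $\delta_\tau U^{n,k+1}:=U^{n,k+1}-U^{n,k}$ and $D^{(3,2)}(c_2,c_3,z)=(d^{(3,2)}_{k\ell}(c_2,c_3,z))$ is the differentiation matrix of the method.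
   Context: $\langle u,v\rangle=v^Tu$ and $\|v\|=\sqrt{\langle v,v\rangle}$ on $\mathbb{R}^M$; Lipschitz is with respect to $\|\cdot\|$. $L_h\in\mathbb{R}^{M\times M}$ is symmetric positive definite. $G_h\ge0$ is a non-negative Lyapunov function with $g_h(v)=-\frac{\delta}{\delta v}G_h(v)$, i.e. the gradient of the scalar function $v\mapsto\langle G_h(v),1\rangle$ is $-g_h(v)$, where $1$ is the all-ones vector. The energy is $E[v]=\frac12\langle v,L_hv\rangle+\langle G_h(v),1\rangle$. Stabilized operators: $L_\kappa:=L_h+\kappa I$, $g_\kappa(u):=g_h(u)+\kappa u$. $\varphi_0(z)=e^z$, $\varphi_{k+1}(z)=(\varphi_k(z)-1/k!)/z$ (entire functions, extended continuously to $z=0$). For a function $f$, $f(-\tau L_\kappa)$ is the matrix function defined through the spectrum of the symmetric matrix $-\tau L_\kappa$. EERK3-2 method (abscissas $c_2\ne\frac23$, $c_3\ne c_2$, $c_3\neq\frac23$; $\gamma:=\frac{(3c_3-2)c_3}{(2-3c_2)c_2}$): $U^{n,1}=u_h^{n-1}$, $U^{n,i+1}=U^{n,1}+\sum_{j=1}^{i}a_{i+1,j}(-\tau L_\kappa)[\tau g_\kappa(U^{n,j})-\tau L_\kappa U^{n,1}]$ for $1\le i\le3$, $u_h^n=U^{n,4}$, with $a_{21}(z)=c_2\varphi_1(c_2z)$; $a_{32}(z)=\gamma c_2\varphi_2(c_2z)+\frac{c_3^2}{c_2}\varphi_2(c_3z)$; $a_{31}(z)=c_3\varphi_1(c_3z)-a_{32}(z)$;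 $a_{42}(z)=\frac{\gamma}{\gamma c_2+c_3}\varphi_2(z)$; $a_{43}(z)=\frac1{\gamma c_2+c_3}\varphi_2(z)$; $a_{41}(z)=\varphi_1(z)-a_{42}(z)-a_{43}(z)$. Differentiation matrix ($s=3$): $\underline a_{i+1,i}:=a_{i+1,i}$, $\underline a_{i+1,j}:=a_{i+1,j}-a_{i,j}$ for $1\le j\le i-1$; $\underline\theta_{k,k}:=1/\underline a_{k+1,k}$, $\underline\theta_{k,j}:=-\sum_{\ell=j+1}^{k}\underline\theta_{k,\ell}\,\underline a_{\ell+1,j}/\underline a_{j+1,j}$ for $1\le j\le k-1$; $d_{k\ell}(z):=\underline\theta_{k\ell}(z)+\frac z2(2-\delta_{k\ell})$ for $1\le\ell\le k\le s$ ($\delta_{k\ell}$ the Kronecker delta) and $d_{k\ell}:=0$ for $\ell>k$. These $d_{k\ell}$ are denoted $d^{(3,2)}_{k\ell}(c_2,c_3,z)$. *)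

theory Defs
  imports "HOL-Analysis.Analysis"
begin

text \<open>
  The functions \<open>\<phi>\<^sub>k\<close>. All matrix arguments below are symmetric, so real arguments suffice.
  The value at the removable singularity \<open>0\<close> is the continuous extension;
  \<open>phi_at_0\<close> and \<open>continuous_phi\<close> show that the limit exists.
\<close>

primrec phi :: "nat \<Rightarrow> real \<Rightarrow> real" where
  "phi 0 = exp"
| "phi (Suc k) = (\<lambda>z. if z = 0 then Lim (at 0) (\<lambda>w. (phi k w - 1 / fact k) / w)
                      else (phi k z - 1 / fact k) / z)"

lemma phi_sums: "(\<lambda>n. z ^ n / fact (n + k)) sums phi k z"
proof (induction k arbitrary: z)
  case 0
  have "(\<lambda>n. z ^ n /\<^sub>R fact n) sums exp z" by (rule exp_converges)
  then show ?case by (simp add: divide_inverse mult.commute)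
next
  case (Suc k)
  define c :: "nat \<Rightarrow> real" where "c n = 1 / fact (n + Suc k)" for n
  have nz: "(\<lambda>n. c n * z ^ n) sums ((phi k z - 1 / fact k) / z)" if "z \<noteq> 0" for z
  proof -
    have "(\<lambda>n. z ^ Suc n / fact (Suc n + k)) sums (phi k z - 1 / fact k)"
      using Suc.IH[of z] by (subst sums_Suc_iff) simp
    then have "(\<lambda>n. z ^ Suc n / fact (Suc n + k) / z) sums ((phi k z - 1 / fact k) / z)"
      by (rule sums_divide)
    moreover have "z ^ Suc n / fact (Suc n + k) / z = c n * z ^ n" for n
      using that by (simp add: c_def)
    ultimately show ?thesis by simp
  qed
  have "((\<lambda>z. (phi k z - 1 / fact k) / z) \<longlongrightarrow> c 0) (at 0)"
    by (rule powser_limit_0_strong[where s = 1 and a = c]) (use nz in auto)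
  then have "Lim (at 0) (\<lambda>z. (phi k z - 1 / fact k) / z) = c 0"
    by (rule tendsto_Lim[OF trivial_limit_at])
  moreover have "(\<lambda>n. c n * 0 ^ n) sums c 0"
    by (rule powser_sums_zero)
  ultimately have "(\<lambda>n. c n * z ^ n) sums phi (Suc k) z"
    using nz[of z] by (cases "z = 0") auto
  then show ?case by (simp add: c_def)
qed

lemma phi_at_0: "phi k 0 = 1 / fact k"
proof -
  have "(\<lambda>n. (1 / fact (n + k)) * 0 ^ n) sums (1 / fact (0 + k) :: real)"
    by (rule powser_sums_zero)
  with phi_sums[of 0 k] show ?thesis by (auto dest: sums_unique2)
qed

lemma continuous_phi: "isCont (phi k) z"
proof -
  have eq: "phi k x = (\<Sum>n. (1 / fact (n + k)) * x ^ n)" for x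
    using phi_sums[of x k] by (simp add: sums_iff)
  have "summable (\<lambda>n. (1 / fact (n + k)) * (\<bar>z\<bar> + 1) ^ n)"
    using phi_sums[of "\<bar>z\<bar> + 1" k] by (simp add: sums_iff)
  then have "isCont (\<lambda>x. \<Sum>n. (1 / fact (n + k)) * x ^ n) z"
    by (rule isCont_powser) auto
  then show ?thesis by (simp add: eq[abs_def])
qed

definition diag_mat :: "real ^ 'm \<Rightarrow> real ^ 'm ^ 'm" where
  "diag_mat d = (\<chi> i j. if i = j then d $ i else 0)"

text \<open>
  The matrix function \<open>f(A)\<close> of a symmetric matrix \<open>A = Q diag(d) Q\<^sup>T\<close> is \<open>Q diag(f(d)) Q\<^sup>T\<close>.
  By \<open>mat_fun_eq\<close> it does not depend on the chosen spectral decomposition.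
\<close>

definition mat_fun :: "(real \<Rightarrow> real) \<Rightarrow> real ^ 'm ^ 'm \<Rightarrow> real ^ 'm ^ 'm" where
  "mat_fun f A = (THE B. \<exists>Q d. orthogonal_matrix Q \<and>
      A = Q ** diag_mat d ** transpose Q \<and>
      B = Q ** diag_mat (\<chi> i. f (d $ i)) ** transpose Q)"

lemma mat_fun_eq:
  fixes Q :: "real ^ 'm ^ 'm"
  assumes Q: "orthogonal_matrix Q" and A: "A = Q ** diag_mat d ** transpose Q"
  shows "mat_fun f A = Q ** diag_mat (\<chi> i. f (d $ i)) ** transpose Q"
  unfolding mat_fun_def
proof (rule the_equality)
  show "\<exists>Q' d'. orthogonal_matrix Q' \<and> A = Q' ** diag_mat d' ** transpose Q' \<and>
      Q ** diag_mat (\<chi> i. f (d $ i)) ** transpose Q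
        = Q' ** diag_mat (\<chi> i. f (d' $ i)) ** transpose Q'"
    using assms by blast
next
  fix B
  assume "\<exists>P e. orthogonal_matrix P \<and> A = P ** diag_mat e ** transpose P \<and>
      B = P ** diag_mat (\<chi> i. f (e $ i)) ** transpose P"
  then obtain P e where P: "orthogonal_matrix P" and A': "A = P ** diag_mat e ** transpose P"
    and B: "B = P ** diag_mat (\<chi> i. f (e $ i)) ** transpose P" by blast
  have QQ: "transpose Q ** Q = mat 1" "Q ** transpose Q = mat 1"
    and PP: "transpose P ** P = mat 1" "P ** transpose P = mat 1"
    using P Q by (auto simp: orthogonal_matrix_def)
  define W where "W = transpose P ** Q"
  have left: "(diag_mat x ** W) $ i $ j = x $ i * W $ i $ j" for x i j
    unfolding matrix_matrix_mult_def diag_mat_def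
    by (simp add: if_distrib[where f = "\<lambda>y. y * _"] cong: if_cong)
  have right: "(W ** diag_mat x) $ i $ j = W $ i $ j * x $ j" for x i j
    unfolding matrix_matrix_mult_def diag_mat_def
    by (simp add: if_distrib[where f = "\<lambda>y. _ * y"] cong: if_cong)
  have "diag_mat e ** W = transpose P ** (P ** diag_mat e ** transpose P) ** Q"
    by (simp add: W_def matrix_mul_assoc PP)
  also have "\<dots> = transpose P ** (Q ** diag_mat d ** transpose Q) ** Q"
    using A A' by simp
  also have "\<dots> = transpose P ** Q ** diag_mat d ** (transpose Q ** Q)"
    by (simp only: matrix_mul_assoc)
  also have "\<dots> = W ** diag_mat d"
    by (simp add: W_def QQ)
  finally have "e $ i * W $ i $ j = W $ i $ j * d $ j" for i j
    by (metis left right)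
  then have "f (e $ i) * W $ i $ j = W $ i $ j * f (d $ j)" for i j
    by (metis mult.commute mult_cancel_right)
  then have "diag_mat (\<chi> i. f (e $ i)) ** W = W ** diag_mat (\<chi> i. f (d $ i))"
    by (simp add: vec_eq_iff left right)
  then have "P ** (diag_mat (\<chi> i. f (e $ i)) ** W) ** transpose Q
      = P ** (W ** diag_mat (\<chi> i. f (d $ i))) ** transpose Q" by simp
  moreover have "P ** (diag_mat (\<chi> i. f (e $ i)) ** W) ** transpose Q
      = P ** diag_mat (\<chi> i. f (e $ i)) ** transpose P ** (Q ** transpose Q)"
    by (simp only: W_def matrix_mul_assoc)
  moreover have "P ** (W ** diag_mat (\<chi> i. f (d $ i))) ** transpose Q
      = (P ** transpose P) ** Q ** diag_mat (\<chi> i. f (d $ i)) ** transpose Q"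
    by (simp only: W_def matrix_mul_assoc)
  ultimately show "B = Q ** diag_mat (\<chi> i. f (d $ i)) ** transpose Q"
    by (simp add: B PP QQ)
qed

definition sym_pos_def :: "real ^ 'm ^ 'm \<Rightarrow> bool" where
  "sym_pos_def A \<longleftrightarrow> transpose A = A \<and> (\<forall>v. v \<noteq> 0 \<longrightarrow> v \<bullet> (A *v v) > 0)"

text \<open>
  \<open>G\<close> is vector valued, so \<open>G \<ge> 0\<close> is componentwise; \<open>g\<close> is minus the
  gradient of the scalar function \<open>v \<mapsto> \<langle>G(v), 1\<rangle>\<close>, with \<open>1\<close> the all-ones vector.
\<close>

definition lyapunov_for :: "(real ^ 'm \<Rightarrow> real ^ 'm) \<Rightarrow> (real ^ 'm \<Rightarrow> real ^ 'm) \<Rightarrow> bool" where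
  "lyapunov_for G g \<longleftrightarrow> (\<forall>v i. G v $ i \<ge> 0) \<and> (\<forall>v. GDERIV (\<lambda>u. G u \<bullet> (\<chi> i. 1)) v :> - g v)"

definition energy :: "real ^ 'm ^ 'm \<Rightarrow> (real ^ 'm \<Rightarrow> real ^ 'm) \<Rightarrow> real ^ 'm \<Rightarrow> real" where
  "energy L G v = 1 / 2 * (v \<bullet> (L *v v)) + G v \<bullet> (\<chi> i. 1)"

definition stab_op :: "real \<Rightarrow> real ^ 'm ^ 'm \<Rightarrow> real ^ 'm ^ 'm" where
  "stab_op \<kappa> L = L + \<kappa> *\<^sub>R mat 1"

definition stab_nonlin :: "real \<Rightarrow> (real ^ 'm \<Rightarrow> real ^ 'm) \<Rightarrow> real ^ 'm \<Rightarrow> real ^ 'm" where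
  "stab_nonlin \<kappa> g u = g u + \<kappa> *\<^sub>R u"

definition gam :: "real \<Rightarrow> real \<Rightarrow> real" where
  "gam c\<^sub>2 c\<^sub>3 = ((3 * c\<^sub>3 - 2) * c\<^sub>3) / ((2 - 3 * c\<^sub>2) * c\<^sub>2)"

definition a32 :: "real \<Rightarrow> real \<Rightarrow> real \<Rightarrow> real" where
  "a32 c\<^sub>2 c\<^sub>3 z = gam c\<^sub>2 c\<^sub>3 * c\<^sub>2 * phi 2 (c\<^sub>2 * z) + c\<^sub>3\<^sup>2 / c\<^sub>2 * phi 2 (c\<^sub>3 * z)"

definition a42 :: "real \<Rightarrow> real \<Rightarrow> real \<Rightarrow> real" where
  "a42 c\<^sub>2 c\<^sub>3 z = gam c\<^sub>2 c\<^sub>3 / (gam c\<^sub>2 c\<^sub>3 * c\<^sub>2 + c\<^sub>3) * phi 2 z"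

definition a43 :: "real \<Rightarrow> real \<Rightarrow> real \<Rightarrow> real" where
  "a43 c\<^sub>2 c\<^sub>3 z = 1 / (gam c\<^sub>2 c\<^sub>3 * c\<^sub>2 + c\<^sub>3) * phi 2 z"

text \<open>The coefficients \<open>a\<^sub>i\<^sub>j\<close> of the EERK3-2 method.\<close>

definition eerk32 :: "real \<Rightarrow> real \<Rightarrow> nat \<Rightarrow> nat \<Rightarrow> real \<Rightarrow> real" where
  "eerk32 c\<^sub>2 c\<^sub>3 i j z =
    (if (i, j) = (2, 1) then c\<^sub>2 * phi 1 (c\<^sub>2 * z)
     else if (i, j) = (3, 1) then c\<^sub>3 * phi 1 (c\<^sub>3 * z) - a32 c\<^sub>2 c\<^sub>3 z
     else if (i, j) = (3, 2) then a32 c\<^sub>2 c\<^sub>3 z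
     else if (i, j) = (4, 1) then phi 1 z - a42 c\<^sub>2 c\<^sub>3 z - a43 c\<^sub>2 c\<^sub>3 z
     else if (i, j) = (4, 2) then a42 c\<^sub>2 c\<^sub>3 z
     else if (i, j) = (4, 3) then a43 c\<^sub>2 c\<^sub>3 z
     else 0)"

text \<open>
  \<open>u n\<close> is the numerical solution and \<open>U n i\<close> the \<open>i\<close>-th stage value of the \<open>n\<close>-th step of the
  \<open>s\<close>-stage method with coefficients \<open>a\<close> and step size \<open>\<tau>\<close>.
\<close>

definition eerk_solution ::
  "nat \<Rightarrow> (nat \<Rightarrow> nat \<Rightarrow> real \<Rightarrow> real) \<Rightarrow> real ^ 'm ^ 'm \<Rightarrow> (real ^ 'm \<Rightarrow> real ^ 'm) \<Rightarrow>
   real \<Rightarrow> real \<Rightarrow> (nat \<Rightarrow> real ^ 'm) \<Rightarrow> (nat \<Rightarrow> nat \<Rightarrow> real ^ 'm) \<Rightarrow> bool" where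
  "eerk_solution s a L g \<kappa> \<tau> u U \<longleftrightarrow>
    (\<forall>n\<ge>1.
      U n 1 = u (n - 1) \<and>
      (\<forall>i\<in>{1..s}. U n (i + 1) = U n 1 +
        (\<Sum>j=1..i. mat_fun (a (i + 1) j) (- (\<tau> *\<^sub>R stab_op \<kappa> L)) *v
          (\<tau> *\<^sub>R stab_nonlin \<kappa> g (U n j) - \<tau> *\<^sub>R (stab_op \<kappa> L *v U n 1)))) \<and>
      u n = U n (s + 1))"

text \<open>
  Coefficients of the scheme for consecutive stage differences, obtained by subtracting the
  equation of stage \<open>i - 1\<close> from that of stage \<open>i\<close>; the kernels \<open>theta\<close> invert this
  lower triangular system pointwise in \<open>z\<close>. Meaningful for \<open>1 \<le> j < i\<close>.
\<close>

definition diff_coeff :: "(nat \<Rightarrow> nat \<Rightarrow> real \<Rightarrow> real) \<Rightarrow> nat \<Rightarrow> nat \<Rightarrow> real \<Rightarrow> real" where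
  "diff_coeff a i j z = (if i = j + 1 then a i j z else a i j z - a (i - 1) j z)"

text \<open>The kernels \<open>\<theta>\<^sub>k\<^sub>j\<close> are only meaningful for \<open>1 \<le> j \<le> k\<close>.\<close>

function (sequential) theta :: "(nat \<Rightarrow> nat \<Rightarrow> real \<Rightarrow> real) \<Rightarrow> nat \<Rightarrow> nat \<Rightarrow> real \<Rightarrow> real" where
  "theta a k j z =
    (if j = k then 1 / diff_coeff a (k + 1) k z
     else - (\<Sum>l\<in>{j+1..k}. theta a k l z * diff_coeff a (l + 1) j z / diff_coeff a (j + 1) j z))"
  by pat_completeness auto
termination
  by (relation "Wellfounded.measure (\<lambda>(a, k, j, z). k - j)") auto

declare theta.simps [simp del]

definition diff_mat :: "(nat \<Rightarrow> nat \<Rightarrow> real \<Rightarrow> real) \<Rightarrow> nat \<Rightarrow> nat \<Rightarrow> real \<Rightarrow> real" where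
  "diff_mat a k l z =
    (if l \<le> k then theta a k l z + z / 2 * (2 - (if k = l then 1 else 0)) else 0)"

definition stage_diff :: "(nat \<Rightarrow> nat \<Rightarrow> real ^ 'm) \<Rightarrow> nat \<Rightarrow> nat \<Rightarrow> real ^ 'm" where
  "stage_diff U n i = U n i - U n (i - 1)"

end

theory Submission
  imports Defs
begin

text \<open>
  Along the stages, \<open>\<Sum>\<^sub>l d\<^sub>k\<^sub>l(-\<tau>L\<^sub>\<kappa>) \<delta>U\<^bsup>l+1\<^esup> = \<tau> (g\<^sub>\<kappa>(U\<^sup>k) - L\<^sub>\<kappa> (U\<^sup>k + U\<^bsup>k+1\<^esup>) / 2)\<close>, so pairing
  with \<open>\<delta>U\<^bsup>k+1\<^esup>\<close> and applying the descent inequality for the Lipschitz gradient of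
  \<open>\<langle>G, 1\<rangle>\<close> gives the first estimate. For the second, diagonalizing \<open>L\<^sub>\<kappa>\<close> reduces
  the claim to \<open>\<Sum>\<^sub>l\<^sub>\<le>\<^sub>k d\<^sub>k\<^sub>l(-x) y\<^sub>k y\<^sub>l \<ge> 0\<close> for every \<open>x > 0\<close>. This form is
  so far from degenerate that bounds of its coefficients by linear functions of \<open>x\<close>, coming from
  low-order Pade approximants of \<open>exp\<close>, suffice.
\<close>

subsection \<open>Bounds for the differentiation matrix\<close>

lemma exp_minus_pade_0_1:
  fixes y :: real
  shows "(1 + y) * exp (- y) \<le> 1"
proof -
  have "1 + y \<le> exp y" by (rule exp_ge_add_one_self)
  then show ?thesis by (simp add: exp_minus divide_simps)
qed

text \<open>The two sides agree at 0 and their difference has derivative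
  \<open>1 - (1 + x) * exp (- x)\<close>, so this is the previous bound integrated.\<close>

lemma exp_minus_pade_1_1:
  fixes y :: real
  assumes "y \<ge> 0"
  shows "2 - y \<le> (2 + y) * exp (- y)"
proof -
  have "(2 + 0) * exp (- 0) - (2 - 0) \<le> (2 + y) * exp (- y) - (2 - y)"
  proof (rule DERIV_nonneg_imp_nondecreasing[OF assms])
    fix x :: real assume "0 \<le> x" "x \<le> y"
    have "((\<lambda>y. (2 + y) * exp (- y) - (2 - y)) has_real_derivative 1 - (1 + x) * exp (- x)) (at x)"
      by (auto intro!: derivative_eq_intros simp: algebra_simps)
    with exp_minus_pade_0_1[of x]
    show "\<exists>d. ((\<lambda>y. (2 + y) * exp (- y) - (2 - y)) has_real_derivative d) (at x) \<and> 0 \<le> d"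
      by fastforce
  qed
  then show ?thesis by simp
qed

text \<open>One more integration: the derivative of the defect is twice the defect of
  \<open>exp_minus_pade_1_1\<close>.\<close>

lemma exp_minus_pade_2_1:
  fixes y :: real
  assumes "y \<ge> 0"
  shows "(6 + 2 * y) * exp (- y) \<le> y\<^sup>2 - 4 * y + 6"
proof -
  have "0\<^sup>2 - 4 * 0 + 6 - (6 + 2 * 0) * exp (- 0) \<le> y\<^sup>2 - 4 * y + 6 - (6 + 2 * y) * exp (- y)"
  proof (rule DERIV_nonneg_imp_nondecreasing[OF assms])
    fix x :: real assume "0 \<le> x" "x \<le> y"
    have "((\<lambda>y. y\<^sup>2 - 4 * y + 6 - (6 + 2 * y) * exp (- y)) has_real_derivative
        2 * ((2 + x) * exp (- x) - (2 - x))) (at x)"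
      by (auto intro!: derivative_eq_intros simp: algebra_simps)
    with exp_minus_pade_1_1[OF \<open>0 \<le> x\<close>]
    show "\<exists>d. ((\<lambda>y. y\<^sup>2 - 4 * y + 6 - (6 + 2 * y) * exp (- y)) has_real_derivative d) (at x) \<and> 0 \<le> d"
      by fastforce
  qed
  then show ?thesis by simp
qed

section \<open>The functions \<open>phi\<close> on the negative axis and linear bounds for
  reciprocals\<close>

lemma phi_1_minus:
  assumes "y > 0"
  shows "phi 1 (- y) = (1 - exp (- y)) / y"
  using assms by (simp add: field_simps)

lemma phi_2_minus:
  assumes "y > 0"
  shows "phi 2 (- y) = (exp (- y) - 1 + y) / y\<^sup>2"
  using assms by (simp add: numeral_2_eq_2 field_simps)

lemma phi_2_minus_pos:
  assumes "y > 0"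
  shows "phi 2 (- y) > 0"
proof -
  have "exp (- y) \<ge> 1 + (- y)" "exp (-y) \<noteq> 1 + (- y)"
    using assms exp_ge_add_one_self[of "-y"] exp_minus_greater[of y] by auto
  then show ?thesis
    using assms by (auto simp: phi_2_minus intro!: divide_pos_pos)
qed

text \<open>After clearing the denominator \<open>exp (- y) - 1 + y\<close>, these are exactly the
  three Pade inequalities. The first bound has the right asymptotics at infinity, the second is
  tangent at \<open>y = 0\<close>.\<close>

lemma inverse_phi_2_bounds:
  assumes "y > 0"
  shows "1 + y \<le> 1 / phi 2 (- y)" and "2 + 2 / 3 * y \<le> 1 / phi 2 (- y)"
    and "1 / phi 2 (- y) \<le> 2 + y"
proof -
  have pos: "exp (- y) - 1 + y > 0"
    using phi_2_minus_pos[OF assms] assms by (simp add: phi_2_minus zero_less_divide_iff)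
  have eq: "1 / phi 2 (- y) = y\<^sup>2 / (exp (- y) - 1 + y)"
    using assms by (simp add: phi_2_minus)
  have "(1 + y) * (exp (- y) - 1 + y) \<le> y\<^sup>2"
    using exp_minus_pade_0_1[of y] assms by (simp add: algebra_simps power2_eq_square)
  then show "1 + y \<le> 1 / phi 2 (- y)"
    unfolding eq using pos by (simp add: pos_le_divide_eq)
  have "(6 + 2 * y) * (exp (- y) - 1 + y) \<le> 3 * y\<^sup>2"
    using exp_minus_pade_2_1[of y] assms by (simp add: algebra_simps power2_eq_square)
  also have "(6 + 2 * y) * (exp (- y) - 1 + y) = 3 * ((2 + 2 / 3 * y) * (exp (- y) - 1 + y))"
    by (simp add: field_simps)
  finally have "(2 + 2 / 3 * y) * (exp (- y) - 1 + y) \<le> y\<^sup>2"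
    by linarith
  then show "2 + 2 / 3 * y \<le> 1 / phi 2 (- y)"
    unfolding eq using pos by (simp add: pos_le_divide_eq)
  have "y\<^sup>2 \<le> (2 + y) * (exp (- y) - 1 + y)"
    using exp_minus_pade_1_1[of y] assms by (simp add: algebra_simps power2_eq_square)
  then show "1 / phi 2 (- y) \<le> 2 + y"
    unfolding eq using pos by (simp add: pos_divide_le_eq)
qed

text \<open>Convex combination of the two lower bounds with weights 3/4 and 1/4: one line that
  serves for all \<open>y > 0\<close>.\<close>

lemma inverse_phi_2_lower:
  assumes "y > 0"
  shows "5 / 4 + 11 / 12 * y \<le> 1 / phi 2 (- y)"
  using inverse_phi_2_bounds(1,2)[OF assms] by linarith

text \<open>The parallel sum \<open>p q / (p + q)\<close> is monotone and superadditive on the positive quadrant.\<close>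

lemma inverse_sum_inverse_lower:
  fixes p q \<alpha> \<beta> s t :: real
  assumes "p > 0" "q > 0" "p \<ge> \<alpha> + s" "q \<ge> \<alpha> + t" "\<alpha> > 0" "s > 0" "t > 0"
  shows "1 / (1 / p + 1 / q) \<ge> \<alpha> / 2 + s * t / (s + t)"
proof -
  have "1 / p + 1 / q \<le> 1 / (\<alpha> + s) + 1 / (\<alpha> + t)"
    using assms by (intro add_mono divide_left_mono) (auto intro!: mult_pos_pos)
  then have "1 / (1 / p + 1 / q) \<ge> 1 / (1 / (\<alpha> + s) + 1 / (\<alpha> + t))"
    using assms by (intro divide_left_mono) (auto intro!: mult_pos_pos add_pos_pos)
  \<comment> \<open>The pair is \<open>(\<alpha>, \<alpha>) + (s, t)\<close>, with parallel sums
    \<open>\<alpha> / 2\<close> and \<open>s * t / (s + t)\<close>. The superadditivity defect is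
    computed exactly and carries the square of \<open>s - t\<close>.\<close>
  moreover have "1 / (1 / (\<alpha> + s) + 1 / (\<alpha> + t)) - (\<alpha> / 2 + s * t / (s + t))
      = \<alpha> * (s - t)\<^sup>2 / (2 * (2 * \<alpha> + s + t) * (s + t))"
  proof -
    have e: "1 / (1 / (\<alpha> + s) + 1 / (\<alpha> + t)) = (\<alpha> + s) * (\<alpha> + t) / (2 * \<alpha> + s + t)"
      using assms by (simp add: divide_simps)
    show ?thesis unfolding e using assms
      by (simp add: divide_simps add_pos_pos) (simp add: algebra_simps power2_eq_square power3_eq_cube)
  qed
  moreover have "\<alpha> * (s - t)\<^sup>2 / (2 * (2 * \<alpha> + s + t) * (s + t)) \<ge> 0"
    using assms by auto
  ultimately show ?thesis by linarith
qed

text \<open>Half the harmonic mean is at most half the arithmetic mean.\<close>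

lemma inverse_sum_inverse_upper:
  fixes p q :: real
  assumes "p > 0" "q > 0"
  shows "1 / (1 / p + 1 / q) \<le> (p + q) / 4"
proof -
  have "1 / (1 / p + 1 / q) = p * q / (p + q)"
    using assms by (simp add: divide_simps)
  moreover have "p * q * 4 \<le> (p + q) * (p + q)"
    using zero_le_power2[of "p - q"] by (simp add: power2_eq_square algebra_simps)
  ultimately show ?thesis using assms by (simp add: divide_simps mult_ac add_ac)
qed

text \<open>For these abscissas \<open>gam\<close> is 16/25, so both weights in \<open>a32\<close>
  equal 12/25. Hence \<open>1 / a32\<close> is 25/12 times the parallel sum of two reciprocals of
  \<open>phi 2\<close>, each with linear bounds.\<close>

lemma a32_bounds:
  assumes "x > 0"
  shows "a32 (3/4) (3/5) (- x) > 0"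
    and "13 / 10 + 63 / 100 * x \<le> 1 / a32 (3/4) (3/5) (- x)"
    and "1 / a32 (3/4) (3/5) (- x) \<le> 25 / 12 + 45 / 64 * x"
proof -
  define f g where "f = phi 2 (- (3 / 4 * x))" and "g = phi 2 (- (3 / 5 * x))"
  have eq: "a32 (3/4) (3/5) (- x) = 12 / 25 * (f + g)"
    by (simp add: a32_def gam_def f_def g_def power2_eq_square field_simps)
  have pos: "f > 0" "g > 0"
    using assms by (auto simp: f_def g_def intro!: phi_2_minus_pos)
  then show "a32 (3/4) (3/5) (- x) > 0" by (simp add: eq)
  have lo: "5 / 4 + 11 / 16 * x \<le> 1 / f" "5 / 4 + 11 / 20 * x \<le> 1 / g"
    using inverse_phi_2_lower[of "3 / 4 * x"] inverse_phi_2_lower[of "3 / 5 * x"] assms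
    by (simp_all add: f_def g_def)
  have hi: "1 / f \<le> 2 + 3 / 4 * x" "1 / g \<le> 2 + 3 / 5 * x"
    using inverse_phi_2_bounds(3)[of "3 / 4 * x"] inverse_phi_2_bounds(3)[of "3 / 5 * x"] assms
    by (simp_all add: f_def g_def)
  define h where "h = 1 / (1 / (1 / f) + 1 / (1 / g))"
  have inv: "1 / a32 (3/4) (3/5) (- x) = 25 / 12 * h"
    using pos by (simp add: eq h_def)
  have "5 / 4 / 2 + (11 / 16 * x) * (11 / 20 * x) / (11 / 16 * x + 11 / 20 * x)
      \<le> h"
    unfolding h_def by (rule inverse_sum_inverse_lower) (use pos lo assms in auto)
  moreover have "(11 / 16 * x) * (11 / 20 * x) / (11 / 16 * x + 11 / 20 * x) = 11 / 36 * x"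
    using assms by (simp add: field_simps)
  ultimately show "13 / 10 + 63 / 100 * x \<le> 1 / a32 (3/4) (3/5) (- x)"
    unfolding inv using assms by linarith
  have "h \<le> (1 / f + 1 / g) / 4"
    unfolding h_def by (rule inverse_sum_inverse_upper) (use pos in auto)
  also have "\<dots> \<le> (2 + 3 / 4 * x + (2 + 3 / 5 * x)) / 4"
    using hi by (intro divide_right_mono add_mono) auto
  finally show "1 / a32 (3/4) (3/5) (- x) \<le> 25 / 12 + 45 / 64 * x"
    unfolding inv by simp
qed


section \<open>Entries of the differentiation matrix and their bounds\<close>

lemma eerk32_coeffs:
  assumes "x > 0"
  defines "a \<equiv> eerk32 (3/4) (3/5)"
  shows "diff_coeff a 2 1 (- x) = (1 - exp (- (3 / 4 * x))) / x"
    and "diff_coeff a 3 1 (- x) = (1 - exp (- (3 / 5 * x))) / x - a32 (3/4) (3/5) (- x)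
           - (1 - exp (- (3 / 4 * x))) / x"
    and "diff_coeff a 3 2 (- x) = a32 (3/4) (3/5) (- x)"
    and "diff_coeff a 4 1 (- x) = (1 - exp (- x)) / x - 41 / 27 * phi 2 (- x)
           - (1 - exp (- (3 / 5 * x))) / x + a32 (3/4) (3/5) (- x)"
    and "diff_coeff a 4 2 (- x) = 16 / 27 * phi 2 (- x) - a32 (3/4) (3/5) (- x)"
    and "diff_coeff a 4 3 (- x) = 25 / 27 * phi 2 (- x)"
proof -
  have p1: "c * phi 1 (c * - x) = (1 - exp (- (c * x))) / x" if "c > 0" for c
    using phi_1_minus[of "c * x"] that assms(1) by (simp del: phi.simps)
  have p1': "phi 1 (- x) = (1 - exp (- x)) / x"
    using phi_1_minus[OF assms(1)] .
  have c: "3 / 4 * phi 1 (3 / 4 * - x) = (1 - exp (- (3 / 4 * x))) / x"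
    "3 / 5 * phi 1 (3 / 5 * - x) = (1 - exp (- (3 / 5 * x))) / x"
    by (rule p1; simp)+
  have g: "gam (3/4) (3/5) = 16 / 25"
    by (simp add: gam_def)
  note defs = a_def diff_coeff_def eerk32_def a42_def a43_def g
  show "diff_coeff a 2 1 (- x) = (1 - exp (- (3 / 4 * x))) / x"
    unfolding defs c by (simp del: phi.simps)
  show "diff_coeff a 3 1 (- x) = (1 - exp (- (3 / 5 * x))) / x - a32 (3/4) (3/5) (- x)
           - (1 - exp (- (3 / 4 * x))) / x"
    unfolding defs c by (simp del: phi.simps)
  show "diff_coeff a 3 2 (- x) = a32 (3/4) (3/5) (- x)"
    unfolding defs c by (simp del: phi.simps)
  show "diff_coeff a 4 1 (- x) = (1 - exp (- x)) / x - 41 / 27 * phi 2 (- x)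
           - (1 - exp (- (3 / 5 * x))) / x + a32 (3/4) (3/5) (- x)"
    unfolding defs c p1' by (simp del: phi.simps)
  show "diff_coeff a 4 2 (- x) = 16 / 27 * phi 2 (- x) - a32 (3/4) (3/5) (- x)"
    unfolding defs c by (simp del: phi.simps)
  show "diff_coeff a 4 3 (- x) = 25 / 27 * phi 2 (- x)"
    unfolding defs c by (simp del: phi.simps)
qed

text \<open>The recursion for \<open>theta\<close> unrolled: back substitution in a lower triangular
  system of size three.\<close>

lemma diff_mat_eq:
  fixes a :: "nat \<Rightarrow> nat \<Rightarrow> real \<Rightarrow> real"
  shows "diff_mat a 1 1 z = 1 / diff_coeff a 2 1 z + z / 2"
    and "diff_mat a 2 2 z = 1 / diff_coeff a 3 2 z + z / 2"
    and "diff_mat a 3 3 z = 1 / diff_coeff a 4 3 z + z / 2"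
    and "diff_mat a 2 1 z = - diff_coeff a 3 1 z / (diff_coeff a 3 2 z * diff_coeff a 2 1 z) + z"
    and "diff_mat a 3 2 z = - diff_coeff a 4 2 z / (diff_coeff a 4 3 z * diff_coeff a 3 2 z) + z"
    and "diff_mat a 3 1 z =
           diff_coeff a 4 2 z * diff_coeff a 3 1 z / (diff_coeff a 4 3 z * diff_coeff a 3 2 z * diff_coeff a 2 1 z)
           - diff_coeff a 4 1 z / (diff_coeff a 4 3 z * diff_coeff a 2 1 z) + z"
  by (simp_all add: diff_mat_def theta.simps numeral_eq_Suc mult_ac)


text \<open>With \<open>s = exp (- w)\<close> the quotient is
  \<open>1 / (1 + s^(-1) + ... + s^(-4))\<close>, and each \<open>s^(-k)\<close> is at least
  \<open>1 + k * w\<close>; these sum to \<open>5 + 10 * w\<close>. The exponents 4 and 5 reflect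
  the ratio of the abscissas 3/5 and 3/4.\<close>

lemma exp_quotient_4_5_bounds:
  fixes w :: real
  assumes "w > 0"
  shows "0 \<le> (exp (- (4 * w)) - exp (- (5 * w))) / (1 - exp (- (5 * w)))"
    and "(exp (- (4 * w)) - exp (- (5 * w))) / (1 - exp (- (5 * w))) \<le> 1 / (5 + 10 * w)"
proof -
  define s where "s = exp (- w)"
  have s: "0 < s" "s < 1" using assms by (auto simp: s_def)
  have pw: "exp (- (4 * w)) = s ^ 4" "exp (- (5 * w)) = s ^ 5"
    by (simp_all add: s_def flip: exp_of_nat_mult)
  have s5: "s ^ 5 < 1" using s by (simp add: power_Suc_less_one power_less_one_iff)
  have "s ^ 5 \<le> s ^ 4" using s by (intro power_decreasing) auto
  then show "0 \<le> (exp (- (4 * w)) - exp (- (5 * w))) / (1 - exp (- (5 * w)))"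
    using s5 by (simp add: pw)
  \<comment> \<open>The bound \<open>1 + k * w \<le> s^(-k)\<close>, multiplied by
    \<open>s^4\<close> to avoid negative powers.\<close>
  have key: "s ^ 4 * (1 + of_nat k * w) \<le> s ^ (4 - k)" if "k \<le> 4" for k
  proof -
    have "(1 + of_nat k * w) * exp (- (of_nat k * w)) \<le> 1"
      by (rule exp_minus_pade_0_1)
    moreover have "exp (- (of_nat k * w)) = s ^ k"
      by (simp add: s_def flip: exp_of_nat_mult)
    ultimately have "s ^ (4 - k) * ((1 + of_nat k * w) * s ^ k) \<le> s ^ (4 - k) * 1"
      using s by (intro mult_left_mono) auto
    moreover have "s ^ (4 - k) * ((1 + of_nat k * w) * s ^ k) = (s ^ (4 - k) * s ^ k) * (1 + of_nat k * w)"
      by simp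
    moreover have "s ^ (4 - k) * s ^ k = s ^ 4"
      using that by (simp flip: power_add)
    ultimately show ?thesis by simp
  qed
  have "s ^ 4 * (5 + 10 * w) \<le> 1 + s + s ^ 2 + s ^ 3 + s ^ 4"
    using key[of 1] key[of 2] key[of 3] key[of 4] s power_le_one[of s 4] by (simp add: algebra_simps)
  then have "(1 - s) * (s ^ 4 * (5 + 10 * w)) \<le> (1 - s) * (1 + s + s ^ 2 + s ^ 3 + s ^ 4)"
    using s by (intro mult_left_mono) auto
  then have "(s ^ 4 - s ^ 5) * (5 + 10 * w) \<le> 1 - s ^ 5"
    by (simp add: algebra_simps power_numeral_reduce)
  then show "(exp (- (4 * w)) - exp (- (5 * w))) / (1 - exp (- (5 * w))) \<le> 1 / (5 + 10 * w)"
    unfolding pw using s5 assms by (simp add: divide_simps)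
qed

text \<open>
  With \<open>v = x / 4\<close> and \<open>R = 1 / \<phi>\<^sub>2(-x)\<close>, this is the part of \<open>d\<^sub>3\<^sub>1\<close> that does not involve
  \<open>a\<^sub>3\<^sub>2\<close>: its two summands cancel well enough only when taken together.
\<close>

lemma exp_quotient_3_4_bounds:
  fixes v R :: real
  assumes v: "v > 0" and R: "2 + 8 / 3 * v \<le> R" "R \<le> 2 + 4 * v"
  defines "q \<equiv> exp (- v)"
  shows "q ^ 3 / (1 - q ^ 3) * (4 * v - 27 / 25 * R * (1 - q)) \<le> 31 / 50"
    and "- (3 / 10) \<le> q ^ 3 / (1 - q ^ 3) * (4 * v - 27 / 25 * R * (1 - q))"
proof -
  define K where "K = q ^ 3 / (1 - q ^ 3)"
  have q: "0 < q" "q < 1" using v by (auto simp: q_def)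
  have q3: "q ^ 3 < 1" using q by (simp add: power_less_one_iff)
  have Kpos: "K > 0" using q q3 by (simp add: K_def)
  \<comment> \<open>\<open>K\<close> is \<open>1 / (exp (3 * v) - 1)\<close>. The quadratic Taylor
    term makes \<open>v * K\<close> decay like \<open>1 / v\<close>, which the lower estimate relies
    on.\<close>
  have "1 + 3 * v + (3 * v)\<^sup>2 / 2 \<le> exp (3 * v)"
    using v by (intro exp_lower_Taylor_quadratic) auto
  then have "(1 + 3 * v + (3 * v)\<^sup>2 / 2) * q ^ 3 \<le> exp (3 * v) * q ^ 3"
    using q by (intro mult_right_mono) auto
  also have "exp (3 * v) * q ^ 3 = 1"
    by (simp add: q_def flip: exp_of_nat_mult exp_add)
  finally have "K * (3 * v + 9 / 2 * v\<^sup>2) \<le> 1"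
    unfolding K_def using q3 by (simp add: divide_simps) (simp add: algebra_simps power2_eq_square)
  then have K: "v * K * (3 + 9 / 2 * v) \<le> 1"
    by (simp add: algebra_simps power2_eq_square)
  have vK: "v * K > 0" using v Kpos by simp
  have K3: "v * K \<le> 1 / 3"
  proof -
    have "v * K * (9 / 2 * v) \<ge> 0" using v vK by simp
    then show ?thesis using K by (simp add: algebra_simps)
  qed

  \<comment> \<open>Upper estimate: \<open>R\<close> is at least \<open>2 * (1 + v)\<close>, which
    cancels the denominator in the bound for \<open>1 - q\<close>, and then \<open>v * K\<close> is
    at most 1/3.\<close>
  have "(1 + v) * q \<le> 1" unfolding q_def by (rule exp_minus_pade_0_1)
  then have lo: "v \<le> (1 + v) * (1 - q)" by (simp add: algebra_simps)
  have "2 * (1 + v) * (1 - q) \<le> R * (1 - q)"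
    using R q v by (intro mult_right_mono) auto
  then have "2 * v \<le> R * (1 - q)" using lo by linarith
  then have "4 * v - 27 / 25 * R * (1 - q) \<le> 46 / 25 * v" by simp
  then have "K * (4 * v - 27 / 25 * R * (1 - q)) \<le> K * (46 / 25 * v)"
    using Kpos by (intro mult_left_mono) auto
  also have "\<dots> \<le> 31 / 50" using K3 by (simp add: mult_ac)
  finally show "q ^ 3 / (1 - q ^ 3) * (4 * v - 27 / 25 * R * (1 - q)) \<le> 31 / 50"
    by (simp add: K_def)

  \<comment> \<open>Lower estimate: after multiplication by \<open>2 + v\<close> the bracket is at
    least \<open>v\<close> times a linear polynomial. Completing the square compares this with
    \<open>(2 + v) * (3 + 9 / 2 * v)\<close>, whose last factor is the one that \<open>K\<close>
    absorbs.\<close>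
  have "2 - v \<le> (2 + v) * q" unfolding q_def using v by (intro exp_minus_pade_1_1) auto
  then have up: "(2 + v) * (1 - q) \<le> 2 * v" by (simp add: algebra_simps)
  have "(2 + v) * (R * (1 - q)) = R * ((2 + v) * (1 - q))" by simp
  also have "\<dots> \<le> (2 + 4 * v) * (2 * v)"
    using R up v q by (intro mult_mono[OF _ up]) auto
  finally have "(2 + v) * (4 * v - 27 / 25 * R * (1 - q)) \<ge> v * (4 * (2 + v) - 27 / 25 * (2 * (2 + 4 * v)))"
    by (simp add: algebra_simps)
  moreover have "4 * (2 + v) - 27 / 25 * (2 * (2 + 4 * v)) \<ge> - (3 / 10) * ((2 + v) * (3 + 9 / 2 * v))"
  proof -
    have "4 * (2 + v) - 27 / 25 * (2 * (2 + 4 * v)) + 3 / 10 * ((2 + v) * (3 + 9 / 2 * v))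
        = 27 / 20 * (v - 52 / 135)\<^sup>2 + (137 / 25 - 27 / 20 * (52 / 135)\<^sup>2)"
      by (simp add: field_simps power2_eq_square)
    also have "\<dots> \<ge> 0" by (simp add: power2_eq_square)
    finally show ?thesis by simp
  qed
  then have "v * (4 * (2 + v) - 27 / 25 * (2 * (2 + 4 * v))) \<ge> v * (- (3 / 10) * ((2 + v) * (3 + 9 / 2 * v)))"
    using v by (intro mult_left_mono) auto
  moreover have "v * (- (3 / 10) * ((2 + v) * (3 + 9 / 2 * v))) = (2 + v) * (- (3 / 10) * (v * (3 + 9 / 2 * v)))"
    by algebra
  ultimately have "(2 + v) * (4 * v - 27 / 25 * R * (1 - q)) \<ge> (2 + v) * (- (3 / 10) * (v * (3 + 9 / 2 * v)))"
    by linarith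
  then have "4 * v - 27 / 25 * R * (1 - q) \<ge> - (3 / 10) * (v * (3 + 9 / 2 * v))"
    by (rule mult_left_le_imp_le) (use v in simp)
  then have "K * (4 * v - 27 / 25 * R * (1 - q)) \<ge> K * (- (3 / 10) * (v * (3 + 9 / 2 * v)))"
    using Kpos by (intro mult_left_mono) auto
  moreover define M where "M = v * K * (3 + 9 / 2 * v)"
  moreover have "K * (- (3 / 10) * (v * (3 + 9 / 2 * v))) = - (3 / 10) * M"
    unfolding M_def by algebra
  moreover have "M \<le> 1" unfolding M_def by (rule K)
  ultimately have "- (3 / 10) \<le> K * (4 * v - 27 / 25 * R * (1 - q))"
    by linarith
  then show "- (3 / 10) \<le> q ^ 3 / (1 - q ^ 3) * (4 * v - 27 / 25 * R * (1 - q))"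
    unfolding K_def .
qed

text \<open>In \<open>d 2 1\<close> and \<open>d 3 1\<close> the terms growing with \<open>x\<close>
  cancel, so these entries are first regrouped into bounded pieces. The entries
  \<open>d 2 2\<close>, \<open>d 3 3\<close> and \<open>d 3 2\<close> follow from the linear bounds
  for the reciprocals of \<open>phi 2\<close> and \<open>a32\<close>, and \<open>d 1 1\<close> from
  a Pade bound.\<close>

lemma diff_mat_eerk32_bounds:
  fixes x :: real
  assumes x: "x > 0"
  defines "d \<equiv> \<lambda>k l. diff_mat (eerk32 (3/4) (3/5)) k l (- x)"
  shows "4 / 3 \<le> d 1 1"
    and "13 / 10 + 13 / 100 * x \<le> d 2 2"
    and "27 / 20 + 49 / 100 * x \<le> d 3 3"
    and "\<bar>d 2 1\<bar> \<le> 181 / 100"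
    and "\<bar>d 3 1\<bar> \<le> 31 / 50"
    and "\<bar>d 3 2\<bar> \<le> 133 / 100 + 37 / 100 * x"
proof -
  \<comment> \<open>Both \<open>3 / 4 * x\<close> and \<open>x\<close> are multiples of
    \<open>v\<close>, so their exponentials become powers of a single \<open>q\<close>.\<close>
  define v where "v = x / 4"
  define q where "q = exp (- v)"
  define a where "a = (1 - q ^ 3) / x"
  define p where "p = (1 - q ^ 4) / x"
  define c where "c = (1 - exp (- (3 / 5 * x))) / x"
  define b where "b = a32 (3/4) (3/5) (- x)"
  define r where "r = phi 2 (- x)"
  have pw: "exp (- (3 / 4 * x)) = q ^ 3" "exp (- x) = q ^ 4"
    by (simp_all add: q_def v_def flip: exp_of_nat_mult)
  have v: "v > 0" using x by (simp add: v_def)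
  have q: "0 < q" "q < 1" using v by (auto simp: q_def)
  have q3: "q ^ 3 < 1" using q by (simp add: power_less_one_iff)
  have apos: "a > 0" using q3 x by (simp add: a_def)
  have bpos: "b > 0" using a32_bounds(1)[OF x] by (simp add: b_def)
  have rpos: "r > 0" using phi_2_minus_pos[OF x] by (simp add: r_def)
  note co = eerk32_coeffs[OF x, unfolded pw, folded a_def p_def c_def b_def r_def]
  have d11: "d 1 1 = 1 / a - x / 2" and d22: "d 2 2 = 1 / b - x / 2"
    and d33: "d 3 3 = 27 / 25 * (1 / r) - x / 2"
    unfolding d_def diff_mat_eq co by simp_all
  \<comment> \<open>The part of \<open>d 2 1\<close> that involves \<open>a32\<close>; multiplied by
    -16/25 it is also the whole dependence of \<open>d 3 1\<close> on \<open>a32\<close>.\<close>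
  define T where "T = (a - c) / (a * b)"
  have d21: "d 2 1 = (1 - x * a) / a + T"
    unfolding d_def diff_mat_eq co T_def using apos bpos by (simp add: field_simps)
  have d32: "d 3 2 = 27 / 25 * (1 / r) - 16 / 25 * (1 / b) - x"
    unfolding d_def diff_mat_eq co using rpos bpos by (simp add: field_simps)
  have d31: "d 3 1 = (1 - x * a) / a - 27 / 25 * ((p - a) / (a * r)) - 16 / 25 * T"
    unfolding d_def diff_mat_eq co T_def using rpos apos bpos by (simp add: field_simps)

  note R = inverse_phi_2_bounds[OF x, folded r_def] inverse_phi_2_lower[OF x, folded r_def]
  note B = a32_bounds(2,3)[OF x, folded b_def]

  have T: "0 \<le> T" "T \<le> 47 / 100"
  proof -
    \<comment> \<open>Now \<open>4 * w\<close> and \<open>5 * w\<close> are \<open>3 / 5 * x\<close>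
      and \<open>3 / 4 * x\<close>, so \<open>T\<close> is the exponential quotient divided by
      \<open>a32\<close>.\<close>
    define w where "w = 3 / 20 * x"
    have w: "w > 0" using x by (simp add: w_def)
    define Q where "Q = (exp (- (4 * w)) - exp (- (5 * w))) / (1 - exp (- (5 * w)))"
    note Q = exp_quotient_4_5_bounds[OF w, folded Q_def]
    have e5: "exp (- (5 * w)) = q ^ 3" "exp (- (4 * w)) = exp (- (3 / 5 * x))"
      by (simp_all add: w_def flip: pw)
    have "T = Q * (1 / b)"
      unfolding T_def Q_def e5 using x q3 bpos by (simp add: a_def c_def divide_simps)
    moreover have "Q * (1 / b) \<le> 1 / (5 + 10 * w) * (25 / 12 + 45 / 64 * x)"
      using Q B bpos w by (intro mult_mono) auto
    moreover have "1 / (5 + 10 * w) * (25 / 12 + 45 / 64 * x) \<le> 47 / 100"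
      using x by (simp add: w_def divide_simps)
    moreover have "0 \<le> Q * (1 / b)" using Q bpos by simp
    ultimately show "0 \<le> T" "T \<le> 47 / 100" by linarith+
  qed

  \<comment> \<open>This is \<open>x / (exp (3 * v) - 1)\<close>, at most 4/3 because
    \<open>exp (3 * v) - 1\<close> is at least \<open>3 / 4 * x\<close>.\<close>
  have ax: "(1 - x * a) / a = x * q ^ 3 / (1 - q ^ 3)"
    using x q3 by (simp add: a_def divide_simps)
  have T1: "0 \<le> (1 - x * a) / a" "(1 - x * a) / a \<le> 4 / 3"
  proof -
    show "0 \<le> (1 - x * a) / a" unfolding ax using x q q3 by simp
    have "(1 + 3 * v) * exp (- (3 * v)) \<le> 1"
      by (rule exp_minus_pade_0_1)
    moreover have "exp (- (3 * v)) = q ^ 3"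
      by (simp add: q_def flip: exp_of_nat_mult)
    ultimately show "(1 - x * a) / a \<le> 4 / 3"
      unfolding ax using q3 by (simp add: v_def divide_simps) (simp add: algebra_simps)
  qed

  show "4 / 3 \<le> d 1 1"
  proof -
    have "2 - 3 / 4 * x \<le> (2 + 3 / 4 * x) * exp (- (3 / 4 * x))"
      using x by (intro exp_minus_pade_1_1) auto
    then have "(4 / 3 + x / 2) * (1 - q ^ 3) \<le> x"
      unfolding pw by (simp add: field_simps)
    then have "4 / 3 + x / 2 \<le> 1 / a"
      using q3 x by (simp add: a_def pos_le_divide_eq)
    then show ?thesis unfolding d11 by simp
  qed
  show "13 / 10 + 13 / 100 * x \<le> d 2 2"
    unfolding d22 using B by simp
  show "27 / 20 + 49 / 100 * x \<le> d 3 3"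
    unfolding d33 using R x by linarith
  show "\<bar>d 2 1\<bar> \<le> 181 / 100"
    unfolding d21 using T T1 by linarith
  show "\<bar>d 3 2\<bar> \<le> 133 / 100 + 37 / 100 * x"
    unfolding d32 abs_le_iff using R B x by linarith
  show "\<bar>d 3 1\<bar> \<le> 31 / 50"
  proof -
    define e where "e = q ^ 3 / (1 - q ^ 3) * (4 * v - 27 / 25 * (1 / r) * (1 - q))"
    have "(1 - x * a) / a - 27 / 25 * ((p - a) / (a * r)) = e"
      unfolding ax e_def using x q3 rpos
      by (simp add: a_def p_def v_def divide_simps) (simp add: algebra_simps power_numeral_reduce)
    moreover have "e \<le> 31 / 50" "- (3 / 10) \<le> e"
      unfolding e_def q_def using R
      by (intro exp_quotient_3_4_bounds[OF v]; simp add: v_def)+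
    ultimately show ?thesis unfolding d31 using T by linarith
  qed
qed

text \<open>Completing the square in \<open>y1\<close>, with \<open>d11\<close> lowered to 4/3,
  leaves a binary form in \<open>y2\<close> and \<open>y3\<close>. Its diagonal is bounded below by
  \<open>P\<close> and \<open>S\<close>, and \<open>4 * P * S\<close> dominates the square of the
  mixed coefficient \<open>C\<close> because the difference is bounded below by a polynomial in
  \<open>x\<close> with positive coefficients.\<close>

lemma ternary_form_nonneg:
  fixes x :: real
  assumes x: "x \<ge> 0" and d: "4 / 3 \<le> d11" "13 / 10 + 13 / 100 * x \<le> d22" "27 / 20 + 49 / 100 * x \<le> d33"
    "\<bar>d21\<bar> \<le> 181 / 100" "\<bar>d31\<bar> \<le> 31 / 50" "\<bar>d32\<bar> \<le> 133 / 100 + 37 / 100 * x"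
  shows "0 \<le> d11 * y1\<^sup>2 + d21 * y1 * y2 + d22 * y2\<^sup>2 + d31 * y1 * y3 + d32 * y2 * y3 + d33 * y3\<^sup>2"
proof -
  define P where "P = 68 / 100 + 13 / 100 * x"
  define S where "S = 127 / 100 + 49 / 100 * x"
  define C where "C = d32 - 3 / 8 * d21 * d31"
  have "d21\<^sup>2 \<le> (181 / 100)\<^sup>2" "d31\<^sup>2 \<le> (31 / 50)\<^sup>2"
    using d by (simp_all add: abs_le_square_iff[symmetric])
  then have P: "P \<le> d22 - 3 / 16 * d21\<^sup>2" and S: "S \<le> d33 - 3 / 16 * d31\<^sup>2"
    using d unfolding P_def S_def by (simp_all add: power2_eq_square)
  have "\<bar>d21 * d31\<bar> \<le> 181 / 100 * (31 / 50)"
    unfolding abs_mult using d by (intro mult_mono) auto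
  then have C: "\<bar>C\<bar> \<le> 176 / 100 + 37 / 100 * x"
    using d(6) unfolding C_def abs_le_iff by (simp add: mult.assoc)
  have "C\<^sup>2 \<le> (176 / 100 + 37 / 100 * x)\<^sup>2"
    using C x by (simp add: abs_le_square_iff[symmetric])
  also have "\<dots> \<le> 4 * P * S"
  proof -
    have "4 * P * S - (176 / 100 + 37 / 100 * x)\<^sup>2
        = 3568 / 10000 + 6908 / 10000 * x + 1179 / 10000 * x\<^sup>2"
      by (simp add: P_def S_def power2_eq_square field_simps)
    also have "\<dots> \<ge> 0" using x by simp
    finally show ?thesis by simp
  qed
  finally have disc: "C\<^sup>2 \<le> 4 * P * S" .
  have Ppos: "P > 0" using x by (simp add: P_def)
  have "4 * P * (P * y2\<^sup>2 + C * y2 * y3 + S * y3\<^sup>2)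
      = (2 * P * y2 + C * y3)\<^sup>2 + (4 * P * S - C\<^sup>2) * y3\<^sup>2"
    by (simp add: power2_eq_square algebra_simps)
  also have "\<dots> \<ge> 0" using disc by simp
  finally have binary: "P * y2\<^sup>2 + C * y2 * y3 + S * y3\<^sup>2 \<ge> 0"
    using Ppos by (simp add: zero_le_mult_iff)
  have "d11 * y1\<^sup>2 + d21 * y1 * y2 + d22 * y2\<^sup>2 + d31 * y1 * y3 + d32 * y2 * y3 + d33 * y3\<^sup>2
      = (d11 - 4 / 3) * y1\<^sup>2 + 4 / 3 * (y1 + 3 / 8 * (d21 * y2 + d31 * y3))\<^sup>2
        + (d22 - 3 / 16 * d21\<^sup>2 - P) * y2\<^sup>2 + (d33 - 3 / 16 * d31\<^sup>2 - S) * y3\<^sup>2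
        + (P * y2\<^sup>2 + C * y2 * y3 + S * y3\<^sup>2)"
    by (simp add: C_def power2_eq_square field_simps)
  also have "\<dots> \<ge> 0"
    using P S d(1) by (intro add_nonneg_nonneg binary mult_nonneg_nonneg) auto
  finally show ?thesis .
qed

subsection \<open>Spectral decomposition of symmetric matrices\<close>

lemma symmetric_inner:
  fixes A :: "real ^ 'm ^ 'm"
  assumes "transpose A = A"
  shows "x \<bullet> (A *v y) = (A *v x) \<bullet> y"
  using dot_lmul_matrix[of x A y] assms by (metis vector_transpose_matrix)

text \<open>The eigenvector maximizes the quadratic form on the unit sphere of the invariant subspace.\<close>

lemma symmetric_eigenvector_in_invariant_subspace:
  fixes A :: "real ^ 'm ^ 'm"
  assumes sym: "transpose A = A" and S: "subspace S" and inv: "\<And>x. x \<in> S \<Longrightarrow> A *v x \<in> S"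
    and ne: "w \<in> S" "w \<noteq> 0"
  obtains v \<mu> where "v \<in> S" "norm v = 1" "A *v v = \<mu> *\<^sub>R v"
proof -
  have "compact (S \<inter> sphere 0 1)"
    using closed_subspace[OF S] by (simp add: closed_Int_compact)
  moreover have "w /\<^sub>R norm w \<in> S \<inter> sphere 0 1"
    using S ne by (auto simp: subspace_scale)
  moreover have "continuous_on (S \<inter> sphere 0 1) (\<lambda>x. x \<bullet> (A *v x))"
    by (intro continuous_intros linear_continuous_on_compose matrix_vector_mul_linear)
  ultimately obtain v where v: "v \<in> S \<inter> sphere 0 1"
    and max: "\<And>y. y \<in> S \<inter> sphere 0 1 \<Longrightarrow> y \<bullet> (A *v y) \<le> v \<bullet> (A *v v)"
    using continuous_attains_sup[of "S \<inter> sphere 0 1" "\<lambda>x. x \<bullet> (A *v x)"] by blast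
  define \<mu> where "\<mu> = v \<bullet> (A *v v)"
  \<comment> \<open>The form of \<open>B\<close> is nonnegative on \<open>S\<close> because
    \<open>\<mu>\<close> is the maximum, and it vanishes at \<open>v\<close>. A perturbation of
    \<open>v\<close> shows that this forces \<open>B v = 0\<close>.\<close>
  define B where "B y = \<mu> *\<^sub>R y - A *v y" for y
  have Bsym: "x \<bullet> B y = B x \<bullet> y" for x y
    by (simp add: B_def inner_diff_left inner_diff_right symmetric_inner[OF sym])
  have Badd: "B (x + t *\<^sub>R y) = B x + t *\<^sub>R B y" for x y t
    by (simp add: B_def algebra_simps matrix_vector_right_distrib matrix_vector_mult_scaleR)
  have nonneg: "y \<bullet> B y \<ge> 0" if "y \<in> S" for y
  proof (cases "y = 0")
    case False
    define n where "n = y /\<^sub>R norm y"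
    have "n \<in> S \<inter> sphere 0 1" using False that S by (auto simp: n_def subspace_scale)
    then have "n \<bullet> (A *v n) \<le> \<mu>" unfolding \<mu>_def by (rule max)
    moreover have "y = norm y *\<^sub>R n" using False by (simp add: n_def)
    then have "y \<bullet> (A *v y) = (norm y)\<^sup>2 * (n \<bullet> (A *v n))"
      by (metis inner_scaleR_left inner_scaleR_right matrix_vector_mult_scaleR mult.assoc power2_eq_square)
    ultimately have "y \<bullet> (A *v y) \<le> (norm y)\<^sup>2 * \<mu>" by (simp add: mult_left_mono)
    then show ?thesis by (simp add: B_def inner_diff_right dot_square_norm mult.commute)
  qed (simp add: B_def)
  have vBv: "v \<bullet> B v = 0"
    using v by (simp add: B_def inner_diff_right dot_square_norm \<mu>_def)
  define h where "h = B v"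
  have hS: "h \<in> S"
    using v S inv by (simp add: h_def B_def subspace_diff subspace_scale)
  have "h \<bullet> h = 0"
  proof (rule ccontr)
    assume "h \<bullet> h \<noteq> 0"
    then have hh: "h \<bullet> h > 0" by simp
    \<comment> \<open>Moving from \<open>v\<close> to \<open>v - t h\<close> changes the form by
      \<open>- 2 t (h . h) + t^2 (h . B h)\<close>. The added 1 keeps the denominator positive and
      makes \<open>t (h . B h)\<close> strictly smaller than \<open>h . h\<close>, so the new value
      is negative.\<close>
    define t where "t = (h \<bullet> h) / (h \<bullet> B h + 1)"
    have pos: "h \<bullet> B h \<ge> 0" by (rule nonneg[OF hS])
    then have t: "t > 0" "t * (h \<bullet> B h) < h \<bullet> h"
      using hh by (auto simp: t_def divide_simps)
    have "v + (- t) *\<^sub>R h \<in> S" using v hS S by (intro subspace_add subspace_scale) auto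
    then have "0 \<le> (v + (- t) *\<^sub>R h) \<bullet> B (v + (- t) *\<^sub>R h)" by (rule nonneg)
    also have "\<dots> = v \<bullet> B v - 2 * t * (h \<bullet> h) + t * (t * (h \<bullet> B h))"
      unfolding Badd using Bsym[of v h]
      by (simp add: inner_add_left inner_add_right inner_diff_left inner_diff_right h_def[symmetric] algebra_simps)
    also have "\<dots> < v \<bullet> B v - 2 * t * (h \<bullet> h) + t * (h \<bullet> h)"
      using t by simp
    also have "\<dots> \<le> 0" using vBv t hh by simp
    finally show False by simp
  qed
  then have "A *v v = \<mu> *\<^sub>R v" by (simp add: h_def B_def)
  with v that show ?thesis by auto
qed

text \<open>Induction on \<open>k\<close>: the orthogonal complement of the eigenvectors found so
  far is nonzero by dimension and invariant by symmetry, so it contains a further unit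
  eigenvector.\<close>

lemma symmetric_orthonormal_eigenvectors:
  fixes A :: "real ^ 'm ^ 'm"
  assumes sym: "transpose A = A" and "k \<le> CARD('m)"
  shows "\<exists>B. finite B \<and> card B = k \<and> pairwise orthogonal B \<and>
    (\<forall>b\<in>B. norm b = 1 \<and> (\<exists>\<mu>. A *v b = \<mu> *\<^sub>R b))"
  using assms(2)
proof (induction k)
  case 0
  then show ?case by (intro exI[of _ "{}"]) auto
next
  case (Suc k)
  then obtain B where B: "finite B" "card B = k" "pairwise orthogonal B"
    and eig: "\<And>b. b \<in> B \<Longrightarrow> norm b = 1 \<and> (\<exists>\<mu>. A *v b = \<mu> *\<^sub>R b)" by auto
  define S where "S = {y. \<forall>b\<in>B. orthogonal b y}"
  have "dim (span B) < DIM(real ^ 'm)"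
    using dim_le_card'[OF B(1)] B(2) Suc.prems by simp
  then obtain w where "w \<noteq> 0" "\<And>y. y \<in> span (span B) \<Longrightarrow> orthogonal w y"
    using orthogonal_to_subspace_exists by blast
  then have w: "w \<in> S" "w \<noteq> 0" by (auto simp: S_def orthogonal_commute span_base)
  have "subspace S"
    by (auto simp: S_def subspace_def orthogonal_def inner_add_right)
  moreover have "A *v x \<in> S" if "x \<in> S" for x
  proof -
    have "b \<bullet> (A *v x) = 0" if b: "b \<in> B" for b
    proof -
      obtain \<mu> where "A *v b = \<mu> *\<^sub>R b" using eig[OF b] by blast
      then have "b \<bullet> (A *v x) = \<mu> * (b \<bullet> x)" by (simp add: symmetric_inner[OF sym])
      also have "b \<bullet> x = 0" using \<open>x \<in> S\<close> b by (simp add: S_def orthogonal_def)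
      finally show ?thesis by simp
    qed
    then show ?thesis by (simp add: S_def orthogonal_def)
  qed
  ultimately obtain v \<mu> where v: "v \<in> S" "norm v = 1" "A *v v = \<mu> *\<^sub>R v"
    using symmetric_eigenvector_in_invariant_subspace[OF sym] w by metis
  have "v \<notin> B"
  proof
    assume "v \<in> B"
    then have "orthogonal v v" using v by (simp add: S_def)
    with v show False by (auto simp: orthogonal_def)
  qed
  then show ?case
    using B eig v by (intro exI[of _ "insert v B"])
      (auto simp: pairwise_insert S_def orthogonal_commute)
qed

text \<open>A full orthonormal set of eigenvectors forms the columns of \<open>Q\<close>, and the
  eigenvalue equations read \<open>A ** Q = Q ** diag_mat d\<close>.\<close>

theorem symmetric_spectral_decomposition:
  fixes A :: "real ^ 'm ^ 'm"
  assumes sym: "transpose A = A"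
  obtains Q d where "orthogonal_matrix Q" "A = Q ** diag_mat d ** transpose Q"
proof -
  obtain B where B: "finite B" "card B = CARD('m)" "pairwise orthogonal B"
    and eig: "\<And>b. b \<in> B \<Longrightarrow> norm b = 1 \<and> (\<exists>\<mu>. A *v b = \<mu> *\<^sub>R b)"
    using symmetric_orthonormal_eigenvectors[OF sym order_refl] by blast
  obtain f where f: "bij_betw f (UNIV :: 'm set) B"
    using finite_same_card_bij[of "UNIV :: 'm set" B] B by auto
  have fB: "f i \<in> B" for i using f by (auto simp: bij_betw_def)
  then have "\<forall>i. \<exists>\<mu>. A *v f i = \<mu> *\<^sub>R f i" using eig by blast
  then obtain \<mu> where \<mu>: "\<And>i. A *v f i = \<mu> i *\<^sub>R f i" by metis
  define Q :: "real ^ 'm ^ 'm" where "Q = (\<chi> i j. f j $ i)"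
  define d :: "real ^ 'm" where "d = (\<chi> i. \<mu> i)"
  have col: "column j Q = f j" for j by (simp add: Q_def column_def vec_eq_iff)
  have Q: "orthogonal_matrix Q"
    unfolding orthogonal_matrix_orthonormal_columns col
  proof (intro conjI allI impI)
    fix i show "norm (f i) = 1" using eig[OF fB] by blast
  next
    fix i j :: 'm assume "i \<noteq> j"
    then have "f i \<noteq> f j" using f by (auto simp: bij_betw_def inj_on_def)
    with B(3) fB show "orthogonal (f i) (f j)" by (simp add: pairwise_def)
  qed
  have "(A ** Q) $ i $ j = (Q ** diag_mat d) $ i $ j" for i j
  proof -
    have "(A ** Q) $ i $ j = (A *v f j) $ i"
      by (simp add: matrix_matrix_mult_def matrix_vector_mult_def Q_def)
    also have "\<dots> = (Q ** diag_mat d) $ i $ j"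
      unfolding \<mu> matrix_matrix_mult_def diag_mat_def
      by (simp add: Q_def d_def if_distrib[where f = "\<lambda>y. _ * y"] cong: if_cong)
    finally show ?thesis .
  qed
  then have "A ** Q = Q ** diag_mat d" by (simp add: vec_eq_iff)
  then have "A ** (Q ** transpose Q) = Q ** diag_mat d ** transpose Q"
    by (simp only: matrix_mul_assoc)
  then have "A = Q ** diag_mat d ** transpose Q"
    using Q by (simp add: orthogonal_matrix_def)
  with Q that show ?thesis by blast
qed

section \<open>Matrix functions in eigencoordinates\<close>

lemma diag_mat_mult_nth: "(diag_mat e *v w) $ i = e $ i * w $ i"
  unfolding matrix_vector_mult_def diag_mat_def
  by (simp add: if_distrib[where f = "\<lambda>y. y * _"] cong: if_cong)

lemma mat_fun_mult_nth:
  fixes Q :: "real ^ 'm ^ 'm"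
  assumes Q: "orthogonal_matrix Q" and A: "A = Q ** diag_mat d ** transpose Q"
  shows "(transpose Q *v (mat_fun f A *v v)) $ i = f (d $ i) * (transpose Q *v v) $ i"
proof -
  have "transpose Q *v (mat_fun f A *v v)
      = (transpose Q ** Q) *v (diag_mat (\<chi> i. f (d $ i)) *v (transpose Q *v v))"
    unfolding mat_fun_eq[OF assms] by (simp add: matrix_vector_mul_assoc matrix_mul_assoc del: transpose_matrix_vector)
  then show ?thesis
    using Q by (simp add: orthogonal_matrix_def diag_mat_mult_nth del: transpose_matrix_vector)
qed

lemma spectral_mult_nth:
  fixes Q :: "real ^ 'm ^ 'm"
  assumes Q: "orthogonal_matrix Q" and A: "A = Q ** diag_mat d ** transpose Q"
  shows "(transpose Q *v (A *v v)) $ i = d $ i * (transpose Q *v v) $ i"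
proof -
  have "transpose Q *v (A *v v) = (transpose Q ** Q) *v (diag_mat d *v (transpose Q *v v))"
    unfolding A by (simp add: matrix_vector_mul_assoc matrix_mul_assoc del: transpose_matrix_vector)
  then show ?thesis
    using Q by (simp add: orthogonal_matrix_def diag_mat_mult_nth del: transpose_matrix_vector)
qed

lemma orthogonal_matrix_inner:
  fixes Q :: "real ^ 'm ^ 'm"
  assumes Q: "orthogonal_matrix Q"
  shows "(transpose Q *v v) \<bullet> (transpose Q *v w) = v \<bullet> w"
proof -
  have "(transpose Q *v v) \<bullet> (transpose Q *v w) = v \<bullet> (Q *v (transpose Q *v w))"
    using dot_lmul_matrix[of v Q "transpose Q *v w"] by (simp only: transpose_matrix_vector)
  then show ?thesis
    using Q by (simp add: matrix_vector_mul_assoc orthogonal_matrix_def del: transpose_matrix_vector)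
qed

lemma orthogonal_matrix_eqI:
  fixes Q :: "real ^ 'm ^ 'm"
  assumes Q: "orthogonal_matrix Q" and eq: "\<And>i. (transpose Q *v v) $ i = (transpose Q *v w) $ i"
  shows "v = w"
proof -
  have "transpose Q *v v = transpose Q *v w" using eq by (simp add: vec_eq_iff)
  then have "Q *v (transpose Q *v v) = Q *v (transpose Q *v w)" by simp
  then show ?thesis using Q by (simp add: matrix_vector_mul_assoc orthogonal_matrix_def del: transpose_matrix_vector)
qed

text \<open>Tested on the \<open>i\<close>-th column of \<open>Q\<close>, the quadratic form takes
  the value \<open>d $ i\<close>.\<close>

lemma spectral_eigenvalue_neg:
  fixes Q :: "real ^ 'm ^ 'm"
  assumes Q: "orthogonal_matrix Q" and A: "A = Q ** diag_mat d ** transpose Q"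
    and neg: "\<And>v. v \<noteq> 0 \<Longrightarrow> v \<bullet> (A *v v) < 0"
  shows "d $ i < 0"
proof -
  define v where "v = Q *v axis i 1"
  have tv: "transpose Q *v v = axis i 1"
    using Q by (simp add: v_def matrix_vector_mul_assoc orthogonal_matrix_def del: transpose_matrix_vector)
  then have "v \<noteq> 0" by (auto simp: axis_eq_0_iff)
  then have "v \<bullet> (A *v v) < 0" by (rule neg)
  also have "v \<bullet> (A *v v) = (\<Sum>k\<in>UNIV. axis i 1 $ k * (d $ k * axis i 1 $ k))"
    using orthogonal_matrix_inner[OF Q, of v "A *v v"]
    by (simp add: inner_vec_def spectral_mult_nth[OF Q A] tv del: transpose_matrix_vector)
  also have "\<dots> = d $ i"
    by (simp add: axis_def if_distrib[where f = "\<lambda>y. y * _"] if_distrib[where f = "\<lambda>y. _ * y"] cong: if_cong)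
  finally show ?thesis .
qed

subsection \<open>Energy estimate\<close>

text \<open>Descent lemma. The gap along the segment from \<open>v\<close> to \<open>w\<close> is
  the function \<open>\<psi>\<close>; Cauchy-Schwarz and the Lipschitz bound make its derivative
  nonpositive.\<close>

lemma lipschitz_gradient_upper_bound:
  fixes F :: "'a :: real_inner \<Rightarrow> real"
  assumes grad: "\<And>v. GDERIV F v :> - g v" and lip: "l-lipschitz_on UNIV g"
  shows "F w - F v \<le> - (g v \<bullet> (w - v)) + l / 2 * (norm (w - v))\<^sup>2"
proof -
  define h where "h = w - v"
  define \<psi> where "\<psi> t = F (v + t *\<^sub>R h) + t * (g v \<bullet> h) - l / 2 * t\<^sup>2 * (norm h)\<^sup>2" for t
  have "\<psi> 1 \<le> \<psi> 0"
  proof (rule DERIV_nonpos_imp_nonincreasing[OF zero_le_one])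
    fix t :: real assume t: "0 \<le> t" "t \<le> 1"
    have "(F has_derivative (\<lambda>k. k \<bullet> (- g (v + t *\<^sub>R h)))) (at (v + t *\<^sub>R h))"
      using grad[of "v + t *\<^sub>R h"] by (simp add: gderiv_def)
    moreover have "((\<lambda>t. v + t *\<^sub>R h) has_derivative (\<lambda>s. s *\<^sub>R h)) (at t)"
      by (auto intro!: derivative_eq_intros)
    ultimately have "((\<lambda>t. F (v + t *\<^sub>R h)) has_derivative (\<lambda>s. (s *\<^sub>R h) \<bullet> (- g (v + t *\<^sub>R h)))) (at t)"
      by (rule has_derivative_compose[rotated])
    then have "((\<lambda>t. F (v + t *\<^sub>R h)) has_real_derivative - (h \<bullet> g (v + t *\<^sub>R h))) (at t)"
      unfolding has_field_derivative_def by (rule has_derivative_eq_rhs) (auto simp: fun_eq_iff)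
    then have "(\<psi> has_real_derivative - (h \<bullet> g (v + t *\<^sub>R h)) + g v \<bullet> h - l * t * (norm h)\<^sup>2) (at t)"
      unfolding \<psi>_def by (auto intro!: derivative_eq_intros)
    moreover have "- (h \<bullet> g (v + t *\<^sub>R h)) + g v \<bullet> h - l * t * (norm h)\<^sup>2 \<le> 0"
    proof -
      have "g v \<bullet> h - h \<bullet> g (v + t *\<^sub>R h) = (g v - g (v + t *\<^sub>R h)) \<bullet> h"
        by (simp add: inner_diff_left inner_commute[of h])
      also have "\<dots> \<le> norm (g v - g (v + t *\<^sub>R h)) * norm h" by (rule norm_cauchy_schwarz)
      also have "\<dots> \<le> (l * (t * norm h)) * norm h"
        using lipschitz_onD[OF lip, of v "v + t *\<^sub>R h"] t
        by (intro mult_right_mono) (auto simp: dist_norm)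
      finally show ?thesis by (simp add: power2_eq_square mult_ac)
    qed
    ultimately show "\<exists>d. (\<psi> has_real_derivative d) (at t) \<and> d \<le> 0" by blast
  qed
  then show ?thesis by (simp add: \<psi>_def h_def inner_commute)
qed

text \<open>By symmetry, \<open>w - v\<close> paired with half of \<open>L (v + w)\<close> is the
  exact increment of the quadratic energy. The stabilization terms combine to
  \<open>\<kappa> / 2\<close> times the squared norm of \<open>w - v\<close>, which absorbs the
  remainder of the descent lemma.\<close>

lemma energy_increment_le:
  fixes L :: "real ^ 'm ^ 'm"
  assumes sym: "transpose L = L" and lyap: "lyapunov_for G g"
    and lip: "l-lipschitz_on UNIV g" and \<kappa>: "\<kappa> \<ge> l"
  shows "energy L G w - energy L G v
    \<le> - ((w - v) \<bullet> (stab_nonlin \<kappa> g v - (1 / 2) *\<^sub>R (stab_op \<kappa> L *v (v + w))))"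
proof -
  have "G w \<bullet> (\<chi> i. 1) - G v \<bullet> (\<chi> i. 1) \<le> - (g v \<bullet> (w - v)) + l / 2 * (norm (w - v))\<^sup>2"
    using lyap by (intro lipschitz_gradient_upper_bound[OF _ lip]) (simp add: lyapunov_for_def)
  moreover have "l / 2 * (norm (w - v))\<^sup>2 \<le> \<kappa> / 2 * ((w - v) \<bullet> (w - v))"
    using \<kappa> by (simp add: power2_norm_eq_inner mult_right_mono)
  moreover have "stab_op \<kappa> L *v x = L *v x + \<kappa> *\<^sub>R x" for x
    by (simp add: stab_op_def matrix_vector_mult_add_rdistrib scaleR_matrix_vector_assoc[symmetric])
  then have "- ((w - v) \<bullet> (stab_nonlin \<kappa> g v - (1 / 2) *\<^sub>R (stab_op \<kappa> L *v (v + w))))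
      = - (g v \<bullet> (w - v)) + 1 / 2 * (w \<bullet> (L *v w)) - 1 / 2 * (v \<bullet> (L *v v)) + \<kappa> / 2 * ((w - v) \<bullet> (w - v))"
    using symmetric_inner[OF sym, of v w]
    by (simp add: stab_nonlin_def matrix_vector_right_distrib inner_add_left inner_add_right
        inner_diff_left inner_diff_right inner_commute field_simps)
  ultimately show ?thesis by (simp add: energy_def)
qed

subsection \<open>Stage differences\<close>

text \<open>Multiplying the recursion for \<open>theta\<close> by its denominator moves the term
  \<open>l = j\<close> into the sum.\<close>

lemma theta_diff_coeff_orthogonal:
  assumes "j \<le> k" and nz: "diff_coeff a (j + 1) j z \<noteq> 0"
  shows "(\<Sum>l=j..k. theta a k l z * diff_coeff a (l + 1) j z) = (if j = k then 1 else 0)"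
proof (cases "j = k")
  case True
  then show ?thesis using nz by (simp add: theta.simps)
next
  case False
  have "(\<Sum>l=j..k. theta a k l z * diff_coeff a (l + 1) j z)
      = theta a k j z * diff_coeff a (j + 1) j z + (\<Sum>l\<in>{j+1..k}. theta a k l z * diff_coeff a (l + 1) j z)"
    using \<open>j \<le> k\<close> by (simp add: sum.atLeast_Suc_atMost)
  also have "theta a k j z * diff_coeff a (j + 1) j z
      = - (\<Sum>l\<in>{j+1..k}. theta a k l z * diff_coeff a (l + 1) j z)"
    using False nz by (subst theta.simps) (simp add: sum_divide_distrib[symmetric])
  finally show ?thesis using False by simp
qed

text \<open>Exchanging the sums over the triangle \<open>j \<le> l \<le> k\<close> turns the inner
  sum into a Kronecker delta.\<close>

lemma theta_inverts_diff_coeff: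
  assumes "1 \<le> k" and nz: "\<And>j. 1 \<le> j \<Longrightarrow> j \<le> k \<Longrightarrow> diff_coeff a (j + 1) j z \<noteq> 0"
  shows "(\<Sum>l=1..k. theta a k l z * (\<Sum>j=1..l. diff_coeff a (l + 1) j z * N j)) = N k"
proof -
  have "(\<Sum>l=1..k. theta a k l z * (\<Sum>j=1..l. diff_coeff a (l + 1) j z * N j))
      = (\<Sum>l=1..k. \<Sum>j | j \<in> {1..k} \<and> j \<le> l. theta a k l z * diff_coeff a (l + 1) j z * N j)"
    by (intro sum.cong refl) (auto simp: sum_distrib_left mult.assoc intro!: sum.cong)
  also have "\<dots> = (\<Sum>j=1..k. \<Sum>l | l \<in> {1..k} \<and> j \<le> l. theta a k l z * diff_coeff a (l + 1) j z * N j)"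
    by (rule sum.swap_restrict) auto
  also have "\<dots> = (\<Sum>j=1..k. (\<Sum>l=j..k. theta a k l z * diff_coeff a (l + 1) j z) * N j)"
    by (intro sum.cong refl) (auto simp: sum_distrib_right intro!: sum.cong)
  also have "\<dots> = (\<Sum>j=1..k. (if j = k then 1 else 0) * N j)"
    using nz by (intro sum.cong refl arg_cong2[where f = "(*)"] theta_diff_coeff_orthogonal) auto
  also have "\<dots> = N k"
    using \<open>1 \<le> k\<close> by (simp add: if_distrib[where f = "\<lambda>y. y * _"] cong: if_cong)
  finally show ?thesis .
qed

lemma uminus_matrix_vector_mult: "(- A) *v v = - (A *v v)"
  for A :: "'a :: ring_1 ^ 'n ^ 'm"
  by (simp add: vec_eq_iff matrix_vector_mult_def sum_negf)

text \<open>In each eigencoordinate the stage differences are triangular combinations of the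
  \<open>N j\<close>, and \<open>theta\<close> recovers \<open>N k\<close>. The additional
  \<open>z / 2\<close> terms telescope and replace the initial stage in \<open>N k\<close> by the
  average of stages \<open>k\<close> and \<open>k + 1\<close>.\<close>

lemma eerk_solution_diff_mat:
  fixes L :: "real ^ 'm ^ 'm"
  assumes sol: "eerk_solution s a L g \<kappa> \<tau> u U" and n: "n \<ge> 1" and k: "1 \<le> k" "k \<le> s"
    and Q: "orthogonal_matrix Q"
    and Z: "- (\<tau> *\<^sub>R stab_op \<kappa> L) = Q ** diag_mat d ** transpose Q"
    and nz: "\<And>i j. 1 \<le> j \<Longrightarrow> j \<le> s \<Longrightarrow> diff_coeff a (j + 1) j (d $ i) \<noteq> 0"
  shows "(\<Sum>l=1..k. mat_fun (diff_mat a k l) (- (\<tau> *\<^sub>R stab_op \<kappa> L)) *v stage_diff U n (l + 1))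
    = \<tau> *\<^sub>R (stab_nonlin \<kappa> g (U n k) - (1 / 2) *\<^sub>R (stab_op \<kappa> L *v (U n k + U n (k + 1))))"
    (is "?lhs = ?rhs")
proof (rule orthogonal_matrix_eqI[OF Q])
  fix i
  define Z where "Z = - (\<tau> *\<^sub>R stab_op \<kappa> L)"
  define z where "z = d $ i"
  define h where "h v = (transpose Q *v v) $ i" for v
  define N where "N j = \<tau> *\<^sub>R stab_nonlin \<kappa> g (U n j) - \<tau> *\<^sub>R (stab_op \<kappa> L *v U n 1)" for j
  have h: "linear h"
    unfolding h_def by (auto intro!: linearI simp: matrix_vector_right_distrib matrix_vector_mult_scaleR
        simp del: transpose_matrix_vector)
  have hf: "h (mat_fun f Z *v v) = f z * h v" for f v
    unfolding h_def z_def Z_def by (rule mat_fun_mult_nth[OF Q Z])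
  have hZ: "h (\<tau> *\<^sub>R (stab_op \<kappa> L *v v)) = - z * h v" for v
  proof -
    have "\<tau> *\<^sub>R (stab_op \<kappa> L *v v) = - (Z *v v)"
      by (simp add: Z_def scaleR_matrix_vector_assoc uminus_matrix_vector_mult)
    then show ?thesis
      using spectral_mult_nth[OF Q Z, of v i, folded h_def z_def Z_def] by (simp add: linear_neg[OF h])
  qed
  \<comment> \<open>The case \<open>l = 0\<close> is the trivial formula for the first stage;
    including it lets the difference of stages 2 and 1 be treated like the others.\<close>
  have hU: "h (U n (l + 1)) = h (U n 1) + (\<Sum>j=1..l. a (l + 1) j z * h (N j))" if "l \<le> s" for l
  proof (cases "l = 0")
    case False
    then have "U n (l + 1) = U n 1 + (\<Sum>j=1..l. mat_fun (a (l + 1) j) Z *v N j)"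
      using sol n that by (auto simp: eerk_solution_def Z_def N_def)
    then show ?thesis by (simp add: linear_add[OF h] linear_sum[OF h] hf)
  qed simp
  have y: "h (stage_diff U n (l + 1)) = (\<Sum>j=1..l. diff_coeff a (l + 1) j z * h (N j))"
    if l: "1 \<le> l" "l \<le> s" for l
  proof -
    obtain m where m: "l = Suc m" using l by (cases l) auto
    have "h (stage_diff U n (l + 1)) = h (U n (l + 1)) - h (U n (m + 1))"
      by (simp add: stage_diff_def linear_diff[OF h] m)
    also have "\<dots> = (\<Sum>j=1..Suc m. a (l + 1) j z * h (N j)) - (\<Sum>j=1..m. a l j z * h (N j))"
      using hU[of l] hU[of m] l by (simp add: m)
    \<comment> \<open>The coefficient of \<open>N l\<close> has no counterpart in the previous
      stage, which is the case \<open>i = j + 1\<close> of \<open>diff_coeff\<close>.\<close>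
    also have "\<dots> = a (l + 1) l z * h (N l) + (\<Sum>j=1..m. (a (l + 1) j z - a l j z) * h (N j))"
      by (simp add: m sum_subtractf algebra_simps)
    also have "(\<Sum>j=1..m. (a (l + 1) j z - a l j z) * h (N j)) = (\<Sum>j=1..m. diff_coeff a (l + 1) j z * h (N j))"
      by (intro sum.cong refl) (auto simp: diff_coeff_def m)
    also have "a (l + 1) l z * h (N l) + \<dots> = (\<Sum>j=1..l. diff_coeff a (l + 1) j z * h (N j))"
      by (simp add: m diff_coeff_def)
    finally show ?thesis .
  qed
  have theta: "(\<Sum>l=1..k. theta a k l z * h (stage_diff U n (l + 1))) = h (N k)"
  proof -
    have "(\<Sum>l=1..k. theta a k l z * h (stage_diff U n (l + 1)))
        = (\<Sum>l=1..k. theta a k l z * (\<Sum>j=1..l. diff_coeff a (l + 1) j z * h (N j)))"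
      using k by (intro sum.cong refl arg_cong2[where f = "(*)"] y) auto
    also have "\<dots> = h (N k)"
      using k nz by (intro theta_inverts_diff_coeff) (auto simp: z_def)
    finally show ?thesis .
  qed
  have tele: "(\<Sum>l=1..k. h (stage_diff U n (l + 1))) = h (U n (k + 1)) - h (U n 1)" for k
    by (induction k) (simp_all add: stage_diff_def linear_diff[OF h])
  have "h ?lhs = (\<Sum>l=1..k. diff_mat a k l z * h (stage_diff U n (l + 1)))"
    by (simp add: linear_sum[OF h] hf flip: Z_def)
  \<comment> \<open>The factor \<open>z / 2 * (2 - delta)\<close> is split into \<open>z\<close>,
    whose sum telescopes, minus \<open>z / 2\<close> on the diagonal.\<close>
  also have "\<dots> = (\<Sum>l=1..k. theta a k l z * h (stage_diff U n (l + 1))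
      + z * h (stage_diff U n (l + 1)) - (if l = k then z / 2 * h (stage_diff U n (l + 1)) else 0))"
    by (intro sum.cong refl) (auto simp: diff_mat_def algebra_simps)
  also have "\<dots> = h (N k) + z * (h (U n (k + 1)) - h (U n 1)) - z / 2 * h (stage_diff U n (k + 1))"
    using k theta tele[of k] by (simp add: sum.distrib sum_subtractf flip: sum_distrib_left)
  also have "\<dots> = \<tau> * h (stab_nonlin \<kappa> g (U n k)) + z / 2 * (h (U n k) + h (U n (k + 1)))"
  proof -
    have "h (N k) = \<tau> * h (stab_nonlin \<kappa> g (U n k)) + z * h (U n 1)"
      unfolding N_def linear_diff[OF h] hZ by (simp add: linear_cmul[OF h])
    then show ?thesis by (simp add: stage_diff_def linear_diff[OF h] field_simps)
  qed
  also have "\<dots> = h ?rhs"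
    using hZ[of "U n k + U n (k + 1)"]
    by (simp add: linear_diff[OF h] linear_cmul[OF h] linear_add[OF h] field_simps)
  finally show "(transpose Q *v ?lhs) $ i = (transpose Q *v ?rhs) $ i"
    by (simp add: h_def)
qed

text \<open>The ternary form at \<open>x = - z\<close>; for \<open>j < 3\<close> the missing
  variables are set to zero.\<close>

lemma diff_mat_eerk32_form_nonneg:
  assumes z: "z < 0" and "j \<le> 3"
  shows "0 \<le> (\<Sum>k=1..j. y k * (\<Sum>l=1..k. diff_mat (eerk32 (3/4) (3/5)) k l z * y l))"
proof -
  define d where "d k l = diff_mat (eerk32 (3/4) (3/5)) k l z" for k l
  have x: "- z > 0" using z by simp
  note form = ternary_form_nonneg[OF less_imp_le[OF x] diff_mat_eerk32_bounds[OF x, unfolded minus_minus, folded d_def]]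
  have "j \<in> {0, 1, 2, 3}" using \<open>j \<le> 3\<close> by auto
  then show ?thesis
    unfolding d_def[symmetric]
    using form[of "y 1" 0 0] form[of "y 1" "y 2" 0] form[of "y 1" "y 2" "y 3"]
    by (auto simp: numeral_eq_Suc algebra_simps)
qed

text \<open>All three diagonal coefficients are positive, so the kernels \<open>theta\<close> really
  invert the triangular system.\<close>

lemma eerk32_diff_coeff_nonzero:
  assumes z: "z < 0" and "1 \<le> j" "j \<le> 3"
  shows "diff_coeff (eerk32 (3/4) (3/5)) (j + 1) j z \<noteq> 0"
proof -
  have x: "- z > 0" using z by simp
  have "j \<in> {1, 2, 3}" using assms by auto
  then show ?thesis
    using eerk32_coeffs[OF x, unfolded minus_minus] a32_bounds(1)[OF x] phi_2_minus_pos[OF x] z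
    by (auto simp del: phi.simps One_nat_def)
qed

section \<open>Energy dissipation at the stages of the EERK3-2 method\<close>

theorem corollary4p3:
  fixes L :: "real ^ 'm ^ 'm"
    and G g :: "real ^ 'm \<Rightarrow> real ^ 'm"
    and \<kappa> \<tau> l\<^sub>g :: real
    and u :: "nat \<Rightarrow> real ^ 'm"
    and U :: "nat \<Rightarrow> nat \<Rightarrow> real ^ 'm"
    and n j :: nat
  assumes "sym_pos_def L"
    and "lyapunov_for G g"
    and "l\<^sub>g > 0"
    and "l\<^sub>g-lipschitz_on UNIV g"
    and "\<kappa> \<ge> 2 * l\<^sub>g"
    and "\<tau> > 0"
    and "eerk_solution 3 (eerk32 (3/4) (3/5)) L g \<kappa> \<tau> u U"
    and "n \<ge> 1"
    and "1 \<le> j" and "j \<le> 3"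
  shows "energy L G (U n (j + 1)) - energy L G (U n 1)
      \<le> - (1 / \<tau>) * (\<Sum>k=1..j. stage_diff U n (k + 1) \<bullet>
            (\<Sum>l=1..k. mat_fun (diff_mat (eerk32 (3/4) (3/5)) k l) (- (\<tau> *\<^sub>R stab_op \<kappa> L))
                       *v stage_diff U n (l + 1)))
    \<and> - (1 / \<tau>) * (\<Sum>k=1..j. stage_diff U n (k + 1) \<bullet>
            (\<Sum>l=1..k. mat_fun (diff_mat (eerk32 (3/4) (3/5)) k l) (- (\<tau> *\<^sub>R stab_op \<kappa> L))
                       *v stage_diff U n (l + 1))) \<le> 0"
proof -
  define Z where "Z = - (\<tau> *\<^sub>R stab_op \<kappa> L)"
  define D where "D = diff_mat (eerk32 (3/4) (3/5))"
  define w where "w k = (\<Sum>l=1..k. mat_fun (D k l) Z *v stage_diff U n (l + 1))" for k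
  have symL: "transpose L = L" and posL: "\<And>v. v \<noteq> 0 \<Longrightarrow> v \<bullet> (L *v v) > 0"
    using assms(1) by (auto simp: sym_pos_def_def)
  have Zv: "Z *v v = - (\<tau> *\<^sub>R (L *v v + \<kappa> *\<^sub>R v))" for v
    by (simp add: Z_def stab_op_def matrix_vector_mult_add_rdistrib scaleR_matrix_vector_assoc[symmetric]
        uminus_matrix_vector_mult)
  have "transpose Z = Z"
    using symL by (simp add: Z_def stab_op_def transpose_def mat_def vec_eq_iff)
  then obtain Q d where Q: "orthogonal_matrix Q" and Zeq: "Z = Q ** diag_mat d ** transpose Q"
    by (rule symmetric_spectral_decomposition)
  \<comment> \<open>The stabilized operator is positive definite, so every eigenvalue of
    \<open>Z\<close> lies where the scalar bounds apply.\<close>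
  have neg: "d $ i < 0" for i
  proof (rule spectral_eigenvalue_neg[OF Q Zeq])
    fix v :: "real ^ 'm" assume "v \<noteq> 0"
    then have "v \<bullet> (L *v v) + \<kappa> * (v \<bullet> v) > 0"
      using posL assms(3,5) by (intro add_pos_nonneg) auto
    then show "v \<bullet> (Z *v v) < 0"
      using \<open>\<tau> > 0\<close> by (simp add: Zv inner_add_right mult_pos_pos)
  qed
  have w: "w k = \<tau> *\<^sub>R (stab_nonlin \<kappa> g (U n k) - (1 / 2) *\<^sub>R (stab_op \<kappa> L *v (U n k + U n (k + 1))))"
    if "1 \<le> k" "k \<le> 3" for k
    unfolding w_def Z_def D_def
    by (rule eerk_solution_diff_mat[OF assms(7,8) that Q Zeq[unfolded Z_def]])
      (use neg eerk32_diff_coeff_nonzero in auto)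
  \<comment> \<open>The vector paired with the stage difference in
    \<open>energy_increment_le\<close> is \<open>w k\<close> divided by
    \<open>\<tau>\<close>.\<close>
  have step: "energy L G (U n (k + 1)) - energy L G (U n k) \<le> - (1 / \<tau>) * (stage_diff U n (k + 1) \<bullet> w k)"
    if "1 \<le> k" "k \<le> 3" for k
    using energy_increment_le[OF symL assms(2,4), of \<kappa> "U n (k + 1)" "U n k"] assms(3,5) \<open>\<tau> > 0\<close>
    by (simp add: w[OF that] stage_diff_def)
  have "energy L G (U n (j + 1)) - energy L G (U n 1)
      = (\<Sum>k=1..j. energy L G (U n (k + 1)) - energy L G (U n k))"
    by (induction j) auto
  also have "\<dots> \<le> (\<Sum>k=1..j. - (1 / \<tau>) * (stage_diff U n (k + 1) \<bullet> w k))"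
    using \<open>j \<le> 3\<close> by (intro sum_mono step) auto
  finally have dissipation: "energy L G (U n (j + 1)) - energy L G (U n 1)
      \<le> - (1 / \<tau>) * (\<Sum>k=1..j. stage_diff U n (k + 1) \<bullet> w k)"
    by (simp add: sum_distrib_left)
  define y where "y i k = (transpose Q *v stage_diff U n (k + 1)) $ i" for i k
  \<comment> \<open>Since \<open>Q\<close> preserves inner products, the pairing decouples into one
    scalar form per eigenvalue.\<close>
  have "stage_diff U n (k + 1) \<bullet> w k = (\<Sum>i\<in>UNIV. y i k * (\<Sum>l=1..k. D k l (d $ i) * y i l))" for k
  proof -
    have "stage_diff U n (k + 1) \<bullet> w k = (transpose Q *v stage_diff U n (k + 1)) \<bullet> (transpose Q *v w k)"
      by (rule orthogonal_matrix_inner[OF Q, symmetric])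
    moreover have "(transpose Q *v w k) $ i = (\<Sum>l=1..k. D k l (d $ i) * y i l)" for i
      unfolding w_def linear_sum[OF matrix_vector_mul_linear] sum_component mat_fun_mult_nth[OF Q Zeq] y_def ..
    ultimately show ?thesis by (simp add: inner_vec_def y_def del: transpose_matrix_vector)
  qed
  then have "(\<Sum>k=1..j. stage_diff U n (k + 1) \<bullet> w k)
      = (\<Sum>i\<in>UNIV. \<Sum>k=1..j. y i k * (\<Sum>l=1..k. D k l (d $ i) * y i l))"
    by (simp only:) (rule sum.swap)
  also have "\<dots> \<ge> 0"
    unfolding D_def by (intro sum_nonneg diff_mat_eerk32_form_nonneg neg \<open>j \<le> 3\<close>)
  finally show ?thesis
    using dissipation \<open>\<tau> > 0\<close> unfolding w_def D_def Z_def by simp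
qed

end
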